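(* Let $\mathcal{G}(\Lambda,T_1,T_2,\mathbf{W}_j)$ be a DVNUG frame for $\ell^2(\Lambda,\mathbb{C}^S)$ with (lower and upper) frame bounds $A_0$ and $B_0$. Let $\{\mathbf{V}_j\}_{j\in T_2}\subset\ell^2(\Lambda,\mathbb{C}^S)$ and let $\theta$ be a positive real constant satisfying $$\big\|\mathcal{F}\big(E_{\frac{m}{M}}(\mathbf{W}_j+\mathbf{V}_j)\big)(\xi)\big\|_{\mathbb{C}^S}\le\theta<2^{M+P}\theta^2S<A_0$$ for $m\in T_1$, $j\in T_2$ and a.e. $\xi\in\Omega$. Then $\mathcal{G}(\Lambda,T_1,T_2,\mathbf{V}_j)$ is also a DVNUG frame for $\ell^2(\Lambda,\mathbb{C}^S)$, with (lower and upper) frame bounds $\big(\sqrt{A_0}-\sqrt{2^{(M+P)}\theta^2S}\big)^2$ and $2^{(M+P+1)}\theta^2S+2B_0$.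
   Context: Standing setting: $N,M,S\in\mathbb{N}$ (positive integers), $P\in\mathbb{N}\cup\{0\}$, $r$ is an odd integer coprime with $N$ with $1\le r\le 2N-1$, $\Lambda=\{0,\frac{r}{N}\}+2\mathbb{Z}$, $\Omega=[0,\frac12)\cup[\frac N2,\frac{N+1}{2})$, $T_1=\{0,1,\dots,M-1\}$, $T_2=\{0,1,\dots,P\}$. For $\mathbf{X}\in\mathbb{C}^S$, $[\mathbf{X}]_k$ is its $k$-th coordinate and $\|\mathbf{X}\|_{\mathbb{C}^S}=(\sum_{k=1}^S|[\mathbf{X}]_k|^2)^{1/2}$. $\ell^2(\Lambda,\mathbb{C}^S)$ is the Hilbert space of families $\mathbf{Z}=\{\mathbf{Z}(\lambda)\}_{\lambda\in\Lambda}\subset\mathbb{C}^S$ with $\sum_{\lambda\in\Lambda}\sum_{k=1}^S|[\mathbf{Z}(\lambda)]_k|^2<\infty$, with inner product $\langle\mathbf{Z},\mathbf{W}\rangle=\sum_{\lambda\in\Lambda}\sum_{k=1}^S[\mathbf{Z}(\lambda)]_k\overline{[\mathbf{W}(\lambda)]_k}$ and induced norm $\|\cdot\|_{\ell^2}$. Operators on $\ell^2(\Lambda,\mathbb{C}^S)$: for $\lambda\in\Lambda$, $(R_{2N\lambda}\mathbf{Z})(\lambda')=\mathbf{Z}(\lambda'-2N\lambda)$, $\lambda'\in\Lambda$ (well defined since $2N\Lambda\subset 2\mathbb{Z}$); for $m\in T_1$, $(E_{\frac mM}\mathbf{Z})(\lambda')=e^{2\pi i\frac mM\lambda'}\mathbf{Z}(\lambda')$,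 $\lambda'\in\Lambda$. Fourier transform: $\mathcal{F}:\ell^2(\Lambda,\mathbb{C}^S)\to L^2(\Omega,\mathbb{C}^S)$, $[\mathcal{F}(\mathbf{Z})(\xi)]_k=\sum_{\lambda\in\Lambda}[\mathbf{Z}(\lambda)]_k e^{2\pi i\lambda\xi}$, $1\le k\le S$ (series convergent in $L^2(\Omega)$). For $\{\mathbf{W}_j\}_{j\in T_2}\subset\ell^2(\Lambda,\mathbb{C}^S)$, $\mathcal{G}(\Lambda,T_1,T_2,\mathbf{W}_j)$ denotes the collection $\{E_{\frac mM}R_{2N\lambda}\mathbf{W}_j:\lambda\in\Lambda,\,m\in T_1,\,j\in T_2\}$ (the discrete vector-valued nonuniform Gabor system, DVNUG system, with window sequences $\mathbf{W}_j$). It is a DVNUG frame for $\ell^2(\Lambda,\mathbb{C}^S)$ with lower and upper frame bounds $\alpha,\beta$ ($0<\alpha\le\beta<\infty$) if $\alpha\|\mathbf{Z}\|_{\ell^2}^2\le\sum_{m\in T_1,\,j\in T_2,\,\lambda\in\Lambda}|\langle\mathbf{Z},E_{\frac mM}R_{2N\lambda}\mathbf{W}_j\rangle|^2\le\beta\|\mathbf{Z}\|_{\ell^2}^2$ for all $\mathbf{Z}\in\ell^2(\Lambda,\mathbb{C}^S)$. *)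

theory Defs
  imports "HOL-Analysis.Analysis"
begin

definition nu_Lambda :: "nat \<Rightarrow> nat \<Rightarrow> real set" where
  "nu_Lambda r N = {a + 2 * real_of_int n | a n. a \<in> {0, real r / real N}}"

definition nu_Omega :: "nat \<Rightarrow> real set" where
  "nu_Omega N = {0..<1/2} \<union> {real N / 2..<(real N + 1) / 2}"

text \<open>A family indexed by \<open>\<Lambda>\<close> is a total function on the reals of which only the values on
  \<open>\<Lambda>\<close> are ever inspected. The dimension \<open>S\<close> is the cardinality of the index type.\<close>

definition ell2 :: "real set \<Rightarrow> (real \<Rightarrow> complex ^ 's) set" where
  "ell2 L = {Z. (\<lambda>l. \<Sum>k\<in>UNIV. (cmod (Z l $ k))\<^sup>2) summable_on L}"

definition ell2_inner :: "real set \<Rightarrow> (real \<Rightarrow> complex ^ 's) \<Rightarrow> (real \<Rightarrow> complex ^ 's) \<Rightarrow> complex" where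
  "ell2_inner L Z W = (\<Sum>\<^sub>\<infinity>l\<in>L. \<Sum>k\<in>UNIV. Z l $ k * cnj (W l $ k))"

definition ell2_norm :: "real set \<Rightarrow> (real \<Rightarrow> complex ^ 's) \<Rightarrow> real" where
  "ell2_norm L Z = sqrt (Re (ell2_inner L Z Z))"

definition translate :: "real \<Rightarrow> (real \<Rightarrow> complex ^ 's) \<Rightarrow> real \<Rightarrow> complex ^ 's" where
  "translate a Z = (\<lambda>l. Z (l - a))"

definition modulate :: "real \<Rightarrow> (real \<Rightarrow> complex ^ 's) \<Rightarrow> real \<Rightarrow> complex ^ 's" where
  "modulate t Z = (\<lambda>l. cis (2 * pi * t * l) *s Z l)"

text \<open>\<open>f\<close> represents the Fourier transform of \<open>Z\<close>: it lies in \<open>L\<^sup>2(\<Omega>, \<complex>\<^sup>S)\<close> and the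
  finite partial sums of the trigonometric series converge to it in that space.\<close>

definition is_nu_fourier ::
  "nat \<Rightarrow> nat \<Rightarrow> (real \<Rightarrow> complex ^ 's) \<Rightarrow> (real \<Rightarrow> complex ^ 's) \<Rightarrow> bool" where
  "is_nu_fourier r N Z f \<longleftrightarrow>
     f \<in> borel_measurable (lebesgue_on (nu_Omega N)) \<and>
     integrable (lebesgue_on (nu_Omega N)) (\<lambda>\<xi>. (norm (f \<xi>))\<^sup>2) \<and>
     ((\<lambda>F. LINT \<xi>|lebesgue_on (nu_Omega N).
             (norm (f \<xi> - (\<Sum>l\<in>F. cis (2 * pi * l * \<xi>) *s Z l)))\<^sup>2) \<longlongrightarrow> 0)
       (finite_subsets_at_top (nu_Lambda r N))"

text \<open>For \<open>Z\<close> in \<open>\<ell>\<^sup>2(\<Lambda>, \<complex>\<^sup>S)\<close> such an \<open>f\<close> exists and is unique almost everywhere, so this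
  chooses a representative of the \<open>L\<^sup>2\<close> class; only almost-everywhere statements about it
  are meaningful.\<close>

definition nu_fourier ::
  "nat \<Rightarrow> nat \<Rightarrow> (real \<Rightarrow> complex ^ 's) \<Rightarrow> real \<Rightarrow> complex ^ 's" where
  "nu_fourier r N Z = (SOME f. is_nu_fourier r N Z f)"

definition dvnug_system ::
  "nat \<Rightarrow> nat \<Rightarrow> (nat \<Rightarrow> real \<Rightarrow> complex ^ 's) \<Rightarrow> nat \<times> nat \<times> real \<Rightarrow> real \<Rightarrow> complex ^ 's" where
  "dvnug_system N M W =
     (\<lambda>(m, j, l). modulate (real m / real M) (translate (2 * real N * l) (W j)))"

text \<open>The system is treated as an indexed family (repeated members count with multiplicity).
  Summability is part of the upper frame inequality, since \<open>infsum\<close> of a divergent family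
  is \<open>0\<close>.\<close>

definition dvnug_frame ::
  "nat \<Rightarrow> nat \<Rightarrow> nat \<Rightarrow> nat \<Rightarrow> (nat \<Rightarrow> real \<Rightarrow> complex ^ 's) \<Rightarrow> real \<Rightarrow> real \<Rightarrow> bool" where
  "dvnug_frame r N M P W \<alpha> \<beta> \<longleftrightarrow>
     (\<forall>j\<in>{0..P}. W j \<in> ell2 (nu_Lambda r N)) \<and> 0 < \<alpha> \<and> \<alpha> \<le> \<beta> \<and>
     (\<forall>Z\<in>ell2 (nu_Lambda r N).
        let I = {0..<M} \<times> {0..P} \<times> nu_Lambda r N;
            c = (\<lambda>i. (cmod (ell2_inner (nu_Lambda r N) Z (dvnug_system N M W i)))\<^sup>2)
        in c summable_on I \<and>
           \<alpha> * (ell2_norm (nu_Lambda r N) Z)\<^sup>2 \<le> infsum c I \<and>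
           infsum c I \<le> \<beta> * (ell2_norm (nu_Lambda r N) Z)\<^sup>2)"

end

theory Submission
  imports Defs
begin

text \<open>The characters \<open>exp (2 \<pi> \<i> \<lambda> \<xi>)\<close> with \<open>\<lambda> \<in> \<Lambda>\<close> are orthonormal on \<open>\<Omega>\<close> (this uses that
  \<open>r\<close> is odd), so the Fourier transform is an isometry. The dilates \<open>2 N \<lambda>\<close> lie in \<open>2\<int> \<subseteq> \<Lambda>\<close>; hence for \<open>Y = E (W\<^sub>j + V\<^sub>j)\<close> the
  combination \<open>\<Sum>\<^sub>a c\<^sub>a R\<^sub>a Y\<close> has transform \<open>p \<cdot> \<F> Y\<close> with a trigonometric polynomial \<open>p\<close> of norm
  \<open>\<parallel>c\<parallel>\<close>, and \<open>|\<F> Y| \<le> \<theta>\<close> bounds its norm by \<open>\<theta> \<parallel>c\<parallel>\<close>. By duality the translates of \<open>Y\<close> form a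
  Bessel family with bound \<open>\<theta>\<^sup>2\<close>, and summing over \<open>m\<close> and \<open>j\<close> the system of \<open>W + V\<close> has Bessel bound
  \<open>M (P + 1) \<theta>\<^sup>2 \<le> 2\<^sup>M\<^sup>+\<^sup>P \<theta>\<^sup>2 S < A\<^sub>0\<close>. The triangle inequality for the analysis coefficients then moves
  the frame property from \<open>W\<close> to \<open>V\<close>.\<close>

subsection \<open>The space \<open>\<ell>\<^sup>2(\<Lambda>)\<close> and the characters on \<open>\<Omega>\<close>\<close>

lemma norm_vec_sq: "(norm (x :: complex ^ 's))\<^sup>2 = (\<Sum>k\<in>UNIV. (cmod (x $ k))\<^sup>2)"
  by (simp add: norm_vec_def L2_set_def sum_nonneg)

lemma norm_scalar_mult: "norm (c *s (x :: complex ^ 's)) = cmod c * norm x"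
proof -
  have "(norm (c *s x))\<^sup>2 = (cmod c * norm x)\<^sup>2"
    by (simp add: norm_vec_sq norm_mult power_mult_distrib sum_distrib_left)
  then show ?thesis by (simp add: power2_eq_iff_nonneg)
qed

lemma vec_Cauchy_Schwarz:
  fixes x y :: "complex ^ 's"
  shows "cmod (\<Sum>k\<in>UNIV. x $ k * cnj (y $ k)) \<le> norm x * norm y"
proof -
  have "cmod (\<Sum>k\<in>UNIV. x $ k * cnj (y $ k)) \<le> (\<Sum>k\<in>UNIV. \<bar>cmod (x $ k)\<bar> * \<bar>cmod (y $ k)\<bar>)"
    by (rule order_trans[OF norm_sum]) (simp add: norm_mult)
  also have "\<dots> \<le> L2_set (\<lambda>k. cmod (x $ k)) UNIV * L2_set (\<lambda>k. cmod (y $ k)) UNIV"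
    by (rule L2_set_mult_ineq)
  finally show ?thesis by (simp add: norm_vec_def)
qed

lemma ell2_iff: "Z \<in> ell2 L \<longleftrightarrow> (\<lambda>l. (norm (Z l))\<^sup>2) summable_on L"
  by (simp add: ell2_def norm_vec_sq)

text \<open>If \<open>f\<close> is not summable, both sides are 0: taking real parts shows that the
  complex family is summable exactly when \<open>f\<close> is.\<close>

lemma infsum_complex_of_real:
  "(\<Sum>\<^sub>\<infinity>x\<in>A. complex_of_real (f x)) = of_real (infsum f A)"
proof (rule infsum_bounded_linear_strong[OF _ bounded_linear_of_real])
  show "(\<lambda>x. complex_of_real (f x)) summable_on A \<longleftrightarrow> f summable_on A"
    using summable_on_bounded_linear[OF bounded_linear_Re, of "\<lambda>x. complex_of_real (f x)" A]
    by (auto intro: summable_on_of_real)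
qed

lemma ell2_inner_self: "ell2_inner L Z Z = of_real (\<Sum>\<^sub>\<infinity>l\<in>L. (norm (Z l))\<^sup>2)"
proof -
  have "(\<Sum>k\<in>UNIV. Z l $ k * cnj (Z l $ k)) = complex_of_real ((norm (Z l))\<^sup>2)" for l
    by (simp only: norm_vec_sq of_real_sum complex_norm_square)
  then show ?thesis
    by (simp only: ell2_inner_def infsum_complex_of_real)
qed

lemma ell2_norm_sq: "(ell2_norm L Z)\<^sup>2 = (\<Sum>\<^sub>\<infinity>l\<in>L. (norm (Z l))\<^sup>2)"
  unfolding ell2_norm_def ell2_inner_self by (simp add: infsum_nonneg)

lemma ell2_norm_nonneg: "0 \<le> ell2_norm L Z"
  unfolding ell2_norm_def ell2_inner_self by (simp add: infsum_nonneg)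

lemma sum_sq_le: "(a + b)\<^sup>2 \<le> 2 * a\<^sup>2 + 2 * (b::real)\<^sup>2"
  using sum_squares_bound[of a b] by (simp add: power2_sum)

lemma ell2_add:
  assumes "Z \<in> ell2 L" "Y \<in> ell2 L"
  shows "(\<lambda>l. Z l + Y l) \<in> ell2 L"
proof -
  have "(\<lambda>l. 2 * (norm (Z l))\<^sup>2 + 2 * (norm (Y l))\<^sup>2) summable_on L"
    using assms by (intro summable_on_add summable_on_cmult_right) (auto simp: ell2_iff)
  then show ?thesis
    unfolding ell2_iff
  proof (rule summable_on_comparison_test)
    fix l
    show "(norm (Z l + Y l))\<^sup>2 \<le> 2 * (norm (Z l))\<^sup>2 + 2 * (norm (Y l))\<^sup>2"
      by (rule order_trans[OF power_mono[OF norm_triangle_ineq] sum_sq_le]) simp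
  qed simp
qed

lemma ell2_modulate: "modulate t Z \<in> ell2 L \<longleftrightarrow> Z \<in> ell2 L"
  by (simp add: ell2_iff modulate_def norm_scalar_mult)

lemma ell2_inner_summable:
  assumes "Z \<in> ell2 L" "Y \<in> ell2 L"
  shows "(\<lambda>l. \<Sum>k\<in>UNIV. Z l $ k * cnj (Y l $ k)) summable_on L"
proof -
  have "(\<lambda>l. (norm (Z l))\<^sup>2 + (norm (Y l))\<^sup>2) summable_on L"
    using assms by (intro summable_on_add) (auto simp: ell2_iff)
  then have "(\<lambda>l. norm (\<Sum>k\<in>UNIV. Z l $ k * cnj (Y l $ k))) summable_on L"
  proof (rule summable_on_comparison_test)
    fix l
    have "norm (\<Sum>k\<in>UNIV. Z l $ k * cnj (Y l $ k)) \<le> norm (Z l) * norm (Y l)"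
      by (rule vec_Cauchy_Schwarz)
    also have "\<dots> \<le> (norm (Z l))\<^sup>2 + (norm (Y l))\<^sup>2"
      using sum_squares_bound[of "norm (Z l)" "norm (Y l)"]
        mult_nonneg_nonneg[OF norm_ge_zero[of "Z l"] norm_ge_zero[of "Y l"]] by linarith
    finally show "norm (\<Sum>k\<in>UNIV. Z l $ k * cnj (Y l $ k)) \<le> (norm (Z l))\<^sup>2 + (norm (Y l))\<^sup>2" .
  qed simp
  then show ?thesis by (rule abs_summable_summable)
qed

section \<open>The index set \<Lambda> and its even translations\<close>

lemma nu_Lambda_shift:
  assumes "l \<in> nu_Lambda r N" shows "l + 2 * real_of_int n \<in> nu_Lambda r N"
proof -
  from assms obtain a k where "l = a + 2 * real_of_int k" "a \<in> {0, real r / real N}"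
    by (auto simp: nu_Lambda_def)
  then have "l + 2 * real_of_int n = a + 2 * real_of_int (k + n)" "a \<in> {0, real r / real N}" by auto
  then show ?thesis unfolding nu_Lambda_def by blast
qed

text \<open>Makes even integers available as frequencies: the multiplier in the synthesis estimate
  is a trigonometric polynomial with such exponents, and orthonormality is known only for
  frequencies in \<Lambda>.\<close>

lemma even_in_nu_Lambda: "2 * real_of_int n \<in> nu_Lambda r N"
  unfolding nu_Lambda_def by (intro CollectI exI[of _ 0] exI[of _ n]) simp

text \<open>Multiplying by \<open>2 * N\<close> clears the denominator of \<open>r / N\<close>, so
  every shift occurring in the Gabor system is an even integer and maps \<Lambda> to itself.\<close>

lemma nu_Lambda_dilate:
  assumes "N \<ge> 1" "l \<in> nu_Lambda r N"
  obtains n where "2 * real N * l = 2 * real_of_int n"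
proof -
  from assms obtain a k where *: "l = a + 2 * real_of_int k" "a \<in> {0, real r / real N}"
    by (auto simp: nu_Lambda_def)
  then consider "2 * real N * l = 2 * real_of_int (2 * int N * k)"
     | "2 * real N * l = 2 * real_of_int (int r + 2 * int N * k)"
    using \<open>N \<ge> 1\<close> by (auto simp: algebra_simps)
  then show ?thesis using that by cases
qed

lemma nu_Lambda_shift_bij:
  "bij_betw (\<lambda>l. l - 2 * real_of_int n) (nu_Lambda r N) (nu_Lambda r N)"
  by (rule bij_betw_byWitness[where f' = "\<lambda>l. l + 2 * real_of_int n"])
     (use nu_Lambda_shift[of _ r N n] nu_Lambda_shift[of _ r N "-n"] in auto)

text \<open>An even shift permutes \<Lambda>, so the sum of squares is only reindexed. Other shifts
  could read values outside \<Lambda>, about which membership in \<open>ell2\<close> says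
  nothing.\<close>

lemma ell2_translate:
  assumes "Z \<in> ell2 (nu_Lambda r N)"
  shows "translate (2 * real_of_int n) Z \<in> ell2 (nu_Lambda r N)"
  using assms summable_on_reindex_bij_betw[OF nu_Lambda_shift_bij, of "\<lambda>l. (norm (Z l))\<^sup>2"]
  by (simp add: ell2_iff translate_def)

section \<open>Integration over \<Omega>\<close>

lemma nu_Omega_measurable: "nu_Omega N \<in> lmeasurable"
  unfolding nu_Omega_def by (intro fmeasurable.Un bounded_set_imp_lmeasurable) auto

lemma measurable_continuous:
  fixes g :: "real \<Rightarrow> 'b::euclidean_space"
  assumes "continuous_on UNIV g"
  shows "g \<in> borel_measurable (lebesgue_on (nu_Omega N))"
  using assms nu_Omega_measurable
  by (auto intro!: continuous_imp_measurable_on_sets_lebesgue dest: fmeasurableD continuous_on_subset)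

lemma integrable_bounded_continuous:
  fixes g :: "real \<Rightarrow> 'b::euclidean_space"
  assumes "continuous_on UNIV g" "\<And>x. norm (g x) \<le> B"
  shows "integrable (lebesgue_on (nu_Omega N)) g"
  by (rule finite_measure.integrable_const_bound[OF finite_measure_lebesgue_on[OF nu_Omega_measurable], where B = B])
     (use assms in \<open>auto intro: measurable_continuous\<close>)

lemma cis_has_integral:
  fixes a b t :: real assumes "t \<noteq> 0" "a \<le> b"
  shows "((\<lambda>x. cis (2 * pi * t * x)) has_integral
      (cis (2 * pi * t * b) - cis (2 * pi * t * a)) / (2 * pi * \<i> * t)) {a..b}"
proof -
  let ?f = "\<lambda>z. exp (2 * pi * \<i> * t * z) / (2 * pi * \<i> * t)"
  have f: "?f (of_real x) = cis (2 * pi * t * x) / (2 * pi * \<i> * t)" for x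
    by (simp add: cis_conv_exp mult_ac)
  have "((\<lambda>x. cis (2 * pi * t * x)) has_integral ?f (of_real b) - ?f (of_real a)) {a..b}"
  proof (rule fundamental_theorem_of_calculus[OF \<open>a \<le> b\<close>])
    fix x
    have "(?f has_field_derivative exp (2 * pi * \<i> * t * of_real x)) (at (of_real x))"
      using \<open>t \<noteq> 0\<close> by (auto intro!: derivative_eq_intros)
    then have "(?f has_field_derivative cis (2 * pi * t * x)) (at (of_real x))"
      by (simp add: cis_conv_exp mult_ac)
    then show "((\<lambda>x. ?f (of_real x)) has_vector_derivative cis (2 * pi * t * x)) (at x within {a..b})"
      by (rule has_vector_derivative_real_field)
  qed
  then show ?thesis by (simp only: f diff_divide_distrib)
qed

text \<open>The half-open intervals making up \<Omega> differ from the closed ones by single points,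
  and they are disjoint for \<open>N \<ge> 1\<close>, so the two integrals add up.\<close>

lemma LINT_nu_Omega:
  fixes g :: "real \<Rightarrow> 'b::euclidean_space"
  assumes "N \<ge> 1" "integrable (lebesgue_on (nu_Omega N)) g"
    and g: "(g has_integral I) {0..1/2}" "(g has_integral J) {real N / 2..(real N + 1) / 2}"
  shows "(LINT \<xi>|lebesgue_on (nu_Omega N). g \<xi>) = I + J"
proof -
  have sub: "{x \<in> {a..b} - {a..<b}. g x \<noteq> 0} \<subseteq> {b}" "{x \<in> {a..<b} - {a..b}. g x \<noteq> 0} \<subseteq> {b}" for a b :: real
    by auto
  have "(g has_integral y) {a..<b}" if "(g has_integral y) {a..b}" for a b y
    using that has_integral_spike_set_eq[OF negligible_subset[OF _ sub(1)] negligible_subset[OF _ sub(2)]]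
    by simp
  then have "(g has_integral I + J) (nu_Omega N)"
    unfolding nu_Omega_def
    using g \<open>N \<ge> 1\<close> by (intro has_integral_Un) (auto intro!: negligible_subset[of "{}"])
  then show ?thesis
    using lebesgue_integral_eq_integral[OF assms(2)] nu_Omega_measurable
    by (auto dest: fmeasurableD)
qed

text \<open>For \<open>t = l - l'\<close> nonzero, the integral is a multiple of
  \<open>(cis (pi * t) - 1) * (1 + cis (pi * t * N))\<close>. The first factor vanishes for
  differences within a coset of the even integers, the second for differences between the two
  cosets.\<close>

lemma nu_Omega_orthonormal:
  assumes "N \<ge> 1" "odd r" "l \<in> nu_Lambda r N" "l' \<in> nu_Lambda r N"
  shows "(LINT \<xi>|lebesgue_on (nu_Omega N). cis (2 * pi * (l - l') * \<xi>)) = of_bool (l = l')"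
proof -
  have int: "integrable (lebesgue_on (nu_Omega N)) (\<lambda>\<xi>. cis (2 * pi * t * \<xi>))" for t
    by (rule integrable_bounded_continuous[where B = 1]) (auto intro!: continuous_intros)
  show ?thesis
  proof (cases "l = l'")
    case True
    \<comment> \<open>Two intervals of length \<open>1/2\<close> give \<Omega> total measure
      1.\<close>
    have "(LINT \<xi>|lebesgue_on (nu_Omega N). (1::complex)) = (1/2) *\<^sub>R 1 + (1/2) *\<^sub>R 1"
      using has_integral_const_real[of "1::complex" 0 "1/2"] int[of 0]
        has_integral_const_real[of "1::complex" "real N / 2" "(real N + 1) / 2"]
      by (intro LINT_nu_Omega \<open>N \<ge> 1\<close>) (auto simp: field_simps)
    then show ?thesis using True by (simp add: scaleR_conv_of_real del: scaleR_half_double)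
  next
    case False
    define t where "t = l - l'"
    have "t \<noteq> 0" using False by (simp add: t_def)
    from assms(3,4) obtain a k a' k' where ll': "l = a + 2 * real_of_int k" "l' = a' + 2 * real_of_int k'"
      and a: "a \<in> {0, real r / real N}" "a' \<in> {0, real r / real N}"
      by (auto simp: nu_Lambda_def)
    consider n where "t = 2 * real_of_int n" | n where "t * real N = real_of_int n" "odd n"
    proof (cases "a = a'")
      case True
      then have "t = 2 * real_of_int (k - k')" by (simp add: t_def ll')
      then show ?thesis using that by blast
    next
      case False
      \<comment> \<open>The sign with which \<open>r / N\<close> enters \<open>a - a'\<close>. As
        \<sigma> is odd, \<open>t * N\<close> has the parity of \<open>r\<close>.\<close>
      define \<sigma> :: int where "\<sigma> = (if a = 0 then -1 else 1)"
      have "(a - a') * real N = real_of_int (\<sigma> * int r)"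
        using False a \<open>N \<ge> 1\<close> by (auto simp: \<sigma>_def)
      then have "t * real N = real_of_int (\<sigma> * int r + 2 * (k - k') * int N)"
        by (simp add: t_def ll' algebra_simps)
      moreover have "odd (\<sigma> * int r + 2 * (k - k') * int N)"
        using \<open>odd r\<close> by (simp add: \<sigma>_def)
      ultimately show ?thesis using that by blast
    qed
    then have zero: "(cis (pi * t) - 1) * (1 + cis (pi * (t * real N))) = 0"
    proof cases
      case (1 n)
      then have "cis (pi * t) = 1"
        using cis_multiple_2pi[of n] by (simp add: mult_ac)
      then show ?thesis by simp
    next
      case (2 n)
      then obtain m where "n = 2 * m + 1" by (auto elim: oddE)
      then have "pi * (t * real N) = 2 * pi * m + pi"
        using 2 by (simp add: algebra_simps)
      then have "cis (pi * (t * real N)) = -1"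
        by (simp flip: cis_mult)
      then show ?thesis by simp
    qed
    have "(LINT \<xi>|lebesgue_on (nu_Omega N). cis (2 * pi * t * \<xi>)) =
      (cis (2 * pi * t * (1/2)) - cis (2 * pi * t * 0)) / (2 * pi * \<i> * t) +
      (cis (2 * pi * t * ((real N + 1) / 2)) - cis (2 * pi * t * (real N / 2))) / (2 * pi * \<i> * t)"
      using \<open>N \<ge> 1\<close> \<open>t \<noteq> 0\<close> by (intro LINT_nu_Omega int cis_has_integral) auto
    also have "2 * pi * t * ((real N + 1) / 2) = pi * t + pi * (t * real N)"
      by (simp add: field_simps)
    also have "2 * pi * t * (real N / 2) = pi * (t * real N)" by simp
    also have "(cis (2 * pi * t * (1/2)) - cis (2 * pi * t * 0)) / (2 * pi * \<i> * t) +
      (cis (pi * t + pi * (t * real N)) - cis (pi * (t * real N))) / (2 * pi * \<i> * t) =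
      ((cis (pi * t) - 1) * (1 + cis (pi * (t * real N)))) / (2 * pi * \<i> * t)"
      by (simp add: algebra_simps flip: cis_mult add_divide_distrib)
    finally show ?thesis using zero False by (simp add: t_def)
  qed
qed

subsection \<open>Trigonometric polynomials and Parseval\<close>

text \<open>These are the partial sums occurring in \<open>is_nu_fourier\<close>, with the finite
  frequency set kept as a separate argument so that it can run through the net of finite subsets of
  \<Lambda>.\<close>

definition trig_poly :: "real set \<Rightarrow> (real \<Rightarrow> complex ^ 's) \<Rightarrow> real \<Rightarrow> complex ^ 's" where
  "trig_poly G a \<xi> = (\<Sum>l\<in>G. cis (2 * pi * l * \<xi>) *s a l)"

lemma continuous_on_trig_poly: "continuous_on A (trig_poly G a)"
  unfolding trig_poly_def vector_scalar_mult_def by (intro continuous_intros)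

lemma norm_trig_poly_le: "norm (trig_poly G a \<xi>) \<le> (\<Sum>l\<in>G. norm (a l))"
  unfolding trig_poly_def by (rule order_trans[OF norm_sum]) (simp add: norm_scalar_mult)

lemma measurable_trig_poly [measurable]:
  "trig_poly G a \<in> borel_measurable (lebesgue_on (nu_Omega N))"
  by (rule measurable_continuous[OF continuous_on_trig_poly])

lemma integrable_trig_poly_sq:
  "integrable (lebesgue_on (nu_Omega N)) (\<lambda>\<xi>. (norm (trig_poly G a \<xi>))\<^sup>2)"
  by (rule integrable_bounded_continuous[where B = "(\<Sum>l\<in>G. norm (a l))\<^sup>2"])
     (auto intro!: continuous_intros continuous_on_trig_poly power_mono norm_trig_poly_le)

text \<open>The common frequencies cancel. What remains lives on \<open>G - H\<close> and
  \<open>H - G\<close>, where tail estimates apply to each polynomial separately.\<close>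

lemma trig_poly_diff:
  assumes "finite G" "finite H"
  shows "trig_poly G a \<xi> - trig_poly H a \<xi> = trig_poly (G - H) a \<xi> - trig_poly (H - G) a \<xi>"
  using sum.Int_Diff[of G "\<lambda>l. cis (2 * pi * l * \<xi>) *s a l" H]
    sum.Int_Diff[of H "\<lambda>l. cis (2 * pi * l * \<xi>) *s a l" G] assms
  by (simp add: trig_poly_def Int_commute)

text \<open>Expanding the square gives a double sum of characters \<open>l - l'\<close>, whose
  integrals vanish off the diagonal. The computation is done over the complex numbers because the
  individual cross terms are not real.\<close>

lemma trig_poly_Parseval:
  assumes "N \<ge> 1" "odd r" "finite G" "G \<subseteq> nu_Lambda r N"
  shows "(LINT \<xi>|lebesgue_on (nu_Omega N). (norm (trig_poly G a \<xi>))\<^sup>2) = (\<Sum>l\<in>G. (norm (a l))\<^sup>2)"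
proof -
  let ?c = "\<lambda>l l'. \<Sum>k\<in>UNIV. a l $ k * cnj (a l' $ k)"
  have diag: "?c l l = of_real ((norm (a l))\<^sup>2)" for l
    by (simp only: norm_vec_sq of_real_sum complex_norm_square)
  have expand: "complex_of_real ((norm (trig_poly G a \<xi>))\<^sup>2) =
      (\<Sum>l\<in>G. \<Sum>l'\<in>G. cis (2 * pi * (l - l') * \<xi>) * ?c l l')" for \<xi>
  proof -
    have c: "cis (2 * pi * (l - l') * \<xi>) = cis (2 * pi * l * \<xi>) * cnj (cis (2 * pi * l' * \<xi>))" for l l'
      by (simp add: cis_cnj cis_mult algebra_simps)
    have "complex_of_real ((norm (trig_poly G a \<xi>))\<^sup>2) =
        (\<Sum>k\<in>UNIV. trig_poly G a \<xi> $ k * cnj (trig_poly G a \<xi> $ k))"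
      by (simp only: norm_vec_sq of_real_sum complex_norm_square)
    also have "\<dots> = (\<Sum>k\<in>UNIV. \<Sum>l\<in>G. \<Sum>l'\<in>G.
        cis (2 * pi * (l - l') * \<xi>) * (a l $ k * cnj (a l' $ k)))"
      unfolding c by (simp add: trig_poly_def sum_product mult_ac)
    also have "\<dots> = (\<Sum>l\<in>G. \<Sum>l'\<in>G. \<Sum>k\<in>UNIV.
        cis (2 * pi * (l - l') * \<xi>) * (a l $ k * cnj (a l' $ k)))"
      by (subst sum.swap, intro sum.cong refl, rule sum.swap)
    finally show ?thesis by (simp only: sum_distrib_left)
  qed
  have int: "integrable (lebesgue_on (nu_Omega N)) (\<lambda>\<xi>. cis (2 * pi * t * \<xi>) * c)" for t c
    by (rule integrable_bounded_continuous[where B = "cmod c"])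
       (auto intro!: continuous_intros simp: norm_mult)
  have "complex_of_real (LINT \<xi>|lebesgue_on (nu_Omega N). (norm (trig_poly G a \<xi>))\<^sup>2) =
     (LINT \<xi>|lebesgue_on (nu_Omega N). (\<Sum>l\<in>G. \<Sum>l'\<in>G. cis (2 * pi * (l - l') * \<xi>) * ?c l l'))"
    unfolding expand[symmetric] by (rule integral_complex_of_real[symmetric])
  also have "\<dots> = (\<Sum>l\<in>G. \<Sum>l'\<in>G. of_bool (l = l') * ?c l l')"
    using assms by (simp add: int nu_Omega_orthonormal subset_iff del: of_bool_eq_iff)
  also have "\<dots> = (\<Sum>l\<in>G. ?c l l)"
    using \<open>finite G\<close> by (intro sum.cong refl) (simp add: of_bool_def if_distrib[of "\<lambda>x. x * _"] sum.delta cong: if_cong)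
  finally show ?thesis
    unfolding diag of_real_sum[symmetric] of_real_eq_iff .
qed

text \<open>Once a finite \<open>G\<close> carries all but \<open>e\<close> of the total sum,
  nonnegativity leaves at most \<open>e\<close> for any finite set disjoint from it.\<close>

lemma summable_on_tail:
  fixes g :: "'a \<Rightarrow> real"
  assumes "g summable_on A" "\<And>x. 0 \<le> g x" "e > 0"
  obtains G where "finite G" "G \<subseteq> A" "\<And>H. finite H \<Longrightarrow> H \<subseteq> A - G \<Longrightarrow> sum g H \<le> e"
proof -
  have "(sum g \<longlongrightarrow> infsum g A) (finite_subsets_at_top A)"
    using assms(1) has_sum_infsum has_sum_def by blast
  then have "\<forall>\<^sub>F G in finite_subsets_at_top A. infsum g A - e < sum g G"
    using \<open>e > 0\<close> by (intro order_tendstoD) auto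
  then obtain G where G: "finite G" "G \<subseteq> A" "infsum g A - e < sum g G"
    by (force simp: eventually_finite_subsets_at_top)
  show ?thesis
  proof (rule that[OF G(1,2)])
    fix H assume H: "finite H" "H \<subseteq> A - G"
    then have "sum g G + sum g H = sum g (G \<union> H)"
      using G by (intro sum.union_disjoint[symmetric]) auto
    also have "\<dots> \<le> infsum g A"
      using assms G H by (intro finite_sum_le_infsum) auto
    finally show "sum g H \<le> e" using G by linarith
  qed
qed

subsection \<open>Existence of the Fourier transform\<close>

lemma norm_add_sq_le: "(norm (x + y))\<^sup>2 \<le> 2 * (norm x)\<^sup>2 + 2 * (norm (y :: 'a::real_normed_vector))\<^sup>2"
  by (rule order_trans[OF power_mono[OF norm_triangle_ineq] sum_sq_le]) simp

lemma norm_diff_sq_le: "(norm (x - y))\<^sup>2 \<le> 2 * (norm x)\<^sup>2 + 2 * (norm (y :: 'a::real_normed_vector))\<^sup>2"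
  using norm_add_sq_le[of x "- y"] by simp

text \<open>The Riesz--Fischer argument: sparse enough partial sums converge almost everywhere, and
  Fatou's lemma turns the limit into the \<open>L\<^sup>2\<close> limit of the whole net.\<close>

lemma nu_fourier_exists:
  fixes Y :: "real \<Rightarrow> complex ^ 's"
  assumes "N \<ge> 1" "odd r" "Y \<in> ell2 (nu_Lambda r N)"
  shows "\<exists>f. is_nu_fourier r N Y f"
proof -
  define \<mu> where "\<mu> = lebesgue_on (nu_Omega N)"
  let ?L = "nu_Lambda r N"
  note [measurable] = measurable_trig_poly[of _ _ N, folded \<mu>_def]
  note Parseval = trig_poly_Parseval[OF assms(1,2), folded \<mu>_def]
  note int_sq = integrable_trig_poly_sq[of N, folded \<mu>_def]
  have sum: "(\<lambda>l. (norm (Y l))\<^sup>2) summable_on ?L"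
    using assms(3) by (simp add: ell2_iff)
  \<comment> \<open>The rate \<open>(1/4) ^ n\<close> is chosen so that squared distances still
    decay geometrically after multiplication by \<open>2 ^ n\<close>, as happens in the bound for
    \<open>d\<close>.\<close>
  have "\<exists>G. finite G \<and> G \<subseteq> ?L \<and> (\<forall>H. finite H \<longrightarrow> H \<subseteq> ?L - G \<longrightarrow> (\<Sum>l\<in>H. (norm (Y l))\<^sup>2) \<le> (1/4) ^ n)" for n
    by (rule summable_on_tail[OF sum, of "(1/4) ^ n"]) auto
  then obtain G' where G': "\<And>n. finite (G' n)" "\<And>n. G' n \<subseteq> ?L"
      "\<And>n H. finite H \<Longrightarrow> H \<subseteq> ?L - G' n \<Longrightarrow> (\<Sum>l\<in>H. (norm (Y l))\<^sup>2) \<le> (1/4) ^ n"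
    by metis
  \<comment> \<open>Unions make the sets increasing, so that all later partial sums contain
    \<open>G n\<close>.\<close>
  define G where "G n = (\<Union>k\<le>n. G' k)" for n :: nat
  have G: "finite (G n)" "G n \<subseteq> ?L" "G' n \<subseteq> G n" for n
    using G' by (auto simp: G_def)
  have G_mono: "G m \<subseteq> G n" if "m \<le> n" for m n
    using that by (force simp: G_def)
  have tail: "(LINT \<xi>|\<mu>. (norm (trig_poly H Y \<xi>))\<^sup>2) \<le> (1/4) ^ n" if "finite H" "H \<subseteq> ?L - G n" for H n
    using that G'(3)[of H n] G(3)[of n] by (subst Parseval) auto
  \<comment> \<open>If both sets contain \<open>G n\<close>, their two differences lie in the tail;
    each contributes at most \<open>2 * (1/4) ^ n\<close>.\<close>
  have near: "(LINT \<xi>|\<mu>. (norm (trig_poly H Y \<xi> - trig_poly K Y \<xi>))\<^sup>2) \<le> 4 * (1/4) ^ n \<and>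
      integrable \<mu> (\<lambda>\<xi>. (norm (trig_poly H Y \<xi> - trig_poly K Y \<xi>))\<^sup>2)"
    if "finite H" "H \<subseteq> ?L" "G n \<subseteq> H" "finite K" "K \<subseteq> ?L" "G n \<subseteq> K" for H K n
  proof
    let ?p = "trig_poly (H - K) Y" and ?q = "trig_poly (K - H) Y"
    have eq: "trig_poly H Y \<xi> - trig_poly K Y \<xi> = ?p \<xi> - ?q \<xi>" for \<xi>
      by (rule trig_poly_diff[OF that(1,4)])
    have int: "integrable \<mu> (\<lambda>\<xi>. 2 * (norm (?p \<xi>))\<^sup>2 + 2 * (norm (?q \<xi>))\<^sup>2)"
      by (intro Bochner_Integration.integrable_add integrable_mult_right int_sq)
    show int': "integrable \<mu> (\<lambda>\<xi>. (norm (trig_poly H Y \<xi> - trig_poly K Y \<xi>))\<^sup>2)"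
      by (rule Bochner_Integration.integrable_bound[OF int]) (auto simp: eq intro!: AE_I2 norm_diff_sq_le)
    have "(LINT \<xi>|\<mu>. (norm (trig_poly H Y \<xi> - trig_poly K Y \<xi>))\<^sup>2) \<le>
        (LINT \<xi>|\<mu>. 2 * (norm (?p \<xi>))\<^sup>2 + 2 * (norm (?q \<xi>))\<^sup>2)"
      unfolding eq by (rule integral_mono[OF int'[unfolded eq] int norm_diff_sq_le])
    also have "\<dots> = 2 * (LINT \<xi>|\<mu>. (norm (?p \<xi>))\<^sup>2) + 2 * (LINT \<xi>|\<mu>. (norm (?q \<xi>))\<^sup>2)"
      by (simp add: int_sq)
    also have "\<dots> \<le> 4 * (1/4) ^ n"
      using tail[OF finite_Diff Diff_mono, OF that(1,2,6)] tail[OF finite_Diff Diff_mono, OF that(4,5,3)]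
      by simp
    finally show "(LINT \<xi>|\<mu>. (norm (trig_poly H Y \<xi> - trig_poly K Y \<xi>))\<^sup>2) \<le> 4 * (1/4) ^ n" .
  qed
  define s where "s n = trig_poly (G n) Y" for n
  have [measurable]: "s n \<in> borel_measurable \<mu>" for n by (simp add: s_def)
  define d where "d n \<xi> = s (Suc n) \<xi> - s n \<xi>" for n \<xi>
  have [measurable]: "d n \<in> borel_measurable \<mu>" for n unfolding d_def[abs_def] by measurable
  \<comment> \<open>Finite measure allows passing from square integrals to integrals of the
    norm.\<close>
  have emeasure_\<mu>: "emeasure \<mu> (space \<mu>) < \<infinity>"
    unfolding \<mu>_def infinity_ennreal_def less_top[symmetric]
    by (rule finite_measure.emeasure_finite[OF finite_measure_lebesgue_on[OF nu_Omega_measurable]])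
  obtain C where C: "C \<ge> 0" "emeasure \<mu> (space \<mu>) = ennreal C"
    using emeasure_\<mu> by (cases "emeasure \<mu> (space \<mu>)") auto
  have d_bound: "(\<integral>\<^sup>+ \<xi>. ennreal (norm (d n \<xi>)) \<partial>\<mu>) \<le> ennreal ((C + 4) * (1/2) ^ n)" for n
  proof -
    \<comment> \<open>The arithmetic-geometric mean inequality with weight \<open>2 ^ n\<close>.
      After integration both summands are of order \<open>(1/2) ^ n\<close>, so the norms of the
      increments are summable almost everywhere.\<close>
    have "norm (d n \<xi>) \<le> (1/2) ^ n + 2 ^ n * (norm (d n \<xi>))\<^sup>2" for \<xi>
    proof -
      have "2 * 2 ^ n * norm (d n \<xi>) \<le> 1 + (2 ^ n * norm (d n \<xi>))\<^sup>2"
        using sum_squares_bound[of 1 "2 ^ n * norm (d n \<xi>)"] by simp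
      moreover have "0 \<le> 2 ^ n * norm (d n \<xi>)" by simp
      ultimately have "2 ^ n * norm (d n \<xi>) \<le> 1 + (2 ^ n * norm (d n \<xi>))\<^sup>2" by linarith
      then have "(1/2) ^ n * (2 ^ n * norm (d n \<xi>)) \<le> (1/2) ^ n * (1 + (2 ^ n * norm (d n \<xi>))\<^sup>2)"
        by (intro mult_left_mono) auto
      then show ?thesis
        by (simp add: power2_eq_square algebra_simps power_one_over)
    qed
    then have "(\<integral>\<^sup>+ \<xi>. ennreal (norm (d n \<xi>)) \<partial>\<mu>) \<le>
        (\<integral>\<^sup>+ \<xi>. ennreal ((1/2) ^ n) + ennreal (2 ^ n) * ennreal ((norm (d n \<xi>))\<^sup>2) \<partial>\<mu>)"
      by (intro nn_integral_mono) (simp flip: ennreal_mult ennreal_plus)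
    also have "\<dots> = ennreal ((1/2) ^ n) * ennreal C + ennreal (2 ^ n) * (\<integral>\<^sup>+ \<xi>. ennreal ((norm (d n \<xi>))\<^sup>2) \<partial>\<mu>)"
      by (simp add: nn_integral_add nn_integral_cmult C)
    also have "(\<integral>\<^sup>+ \<xi>. ennreal ((norm (d n \<xi>))\<^sup>2) \<partial>\<mu>) \<le> ennreal (4 * (1/4) ^ n)"
      using near[of "G (Suc n)" n "G n"] G G_mono[of n "Suc n"]
      by (subst nn_integral_eq_integral) (auto simp: d_def s_def intro!: ennreal_leI)
    also have "ennreal ((1/2) ^ n) * ennreal C + ennreal (2 ^ n) * ennreal (4 * (1/4) ^ n) =
        ennreal ((1/2) ^ n * C + 2 ^ n * (4 * (1/4) ^ n))"
      using C by (simp flip: ennreal_mult ennreal_plus)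
    also have "(1/2) ^ n * C + 2 ^ n * (4 * (1/4) ^ n) = (C + 4) * (1/2::real) ^ n"
      by (simp add: algebra_simps flip: power_mult_distrib)
    finally show ?thesis by (simp add: add_left_mono mult_left_mono)
  qed
  have "(\<integral>\<^sup>+ \<xi>. (\<Sum>n. ennreal (norm (d n \<xi>))) \<partial>\<mu>) = (\<Sum>n. \<integral>\<^sup>+ \<xi>. ennreal (norm (d n \<xi>)) \<partial>\<mu>)"
    by (rule nn_integral_suminf) simp
  also have "\<dots> \<le> (\<Sum>n. ennreal ((C + 4) * (1/2) ^ n))"
    by (intro suminf_le d_bound) auto
  also have "\<dots> = ennreal (\<Sum>n. (C + 4) * (1/2) ^ n)"
    using C by (intro suminf_ennreal2 summable_mult summable_geometric) auto
  also have "\<dots> < \<infinity>" by simp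
  finally have "AE \<xi> in \<mu>. (\<Sum>n. ennreal (norm (d n \<xi>))) \<noteq> \<infinity>"
    by (intro nn_integral_PInf_AE) auto
  then have conv: "AE \<xi> in \<mu>. (\<lambda>n. s n \<xi>) \<longlonglongrightarrow> lim (\<lambda>n. s n \<xi>)"
  proof eventually_elim
    case (elim \<xi>)
    then have "summable (\<lambda>n. norm (d n \<xi>))"
      by (intro summable_suminf_not_top) auto
    then have "summable (\<lambda>n. d n \<xi>)" by (rule summable_norm_cancel)
    then have "convergent (\<lambda>m. \<Sum>n<m. d n \<xi>)" by (simp add: summable_iff_convergent)
    then have "convergent (\<lambda>m. (s m \<xi> - s 0 \<xi>) + s 0 \<xi>)"
      unfolding d_def by (intro convergent_add convergent_const) (simp add: sum_lessThan_telescope[of "\<lambda>n. s n \<xi>"])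
    then show ?case by (simp add: convergent_LIMSEQ_iff)
  qed
  define f where "f \<xi> = lim (\<lambda>n. s n \<xi>)" for \<xi>
  have [measurable]: "f \<in> borel_measurable \<mu>" unfolding f_def by measurable
  have close: "(\<integral>\<^sup>+ \<xi>. ennreal ((norm (f \<xi> - trig_poly H Y \<xi>))\<^sup>2) \<partial>\<mu>) \<le> ennreal (4 * (1/4) ^ n)"
    if H: "finite H" "H \<subseteq> ?L" "G n \<subseteq> H" for H n
  proof -
    \<comment> \<open>The limit is almost everywhere a lower limit, so Fatou's lemma transfers the
      uniform bound \<open>near\<close> from the partial sums \<open>s m\<close> to
      \<open>f\<close>.\<close>
    have "(\<integral>\<^sup>+ \<xi>. ennreal ((norm (f \<xi> - trig_poly H Y \<xi>))\<^sup>2) \<partial>\<mu>) =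
        (\<integral>\<^sup>+ \<xi>. liminf (\<lambda>m. ennreal ((norm (s m \<xi> - trig_poly H Y \<xi>))\<^sup>2)) \<partial>\<mu>)"
    proof (rule nn_integral_cong_AE, use conv in eventually_elim)
      case (elim \<xi>)
      then have "(\<lambda>m. ennreal ((norm (s m \<xi> - trig_poly H Y \<xi>))\<^sup>2)) \<longlonglongrightarrow> ennreal ((norm (f \<xi> - trig_poly H Y \<xi>))\<^sup>2)"
        unfolding f_def[symmetric] by (intro tendsto_intros)
      then show ?case by (rule lim_imp_Liminf[OF trivial_limit_sequentially, symmetric])
    qed
    also have "\<dots> \<le> liminf (\<lambda>m. \<integral>\<^sup>+ \<xi>. ennreal ((norm (s m \<xi> - trig_poly H Y \<xi>))\<^sup>2) \<partial>\<mu>)"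
      by (rule nn_integral_liminf) simp
    also have "\<dots> \<le> limsup (\<lambda>m. \<integral>\<^sup>+ \<xi>. ennreal ((norm (s m \<xi> - trig_poly H Y \<xi>))\<^sup>2) \<partial>\<mu>)"
      by (rule Liminf_le_Limsup) simp
    also have "\<dots> \<le> ennreal (4 * (1/4) ^ n)"
    proof (rule Limsup_bounded, rule eventually_sequentiallyI[of n])
      fix m assume "n \<le> m"
      then show "(\<integral>\<^sup>+ \<xi>. ennreal ((norm (s m \<xi> - trig_poly H Y \<xi>))\<^sup>2) \<partial>\<mu>) \<le> ennreal (4 * (1/4) ^ n)"
        using near[of "G m" n H] H G G_mono[of n m]
        by (subst nn_integral_eq_integral) (auto simp: s_def intro!: ennreal_leI)
    qed
    finally show ?thesis .
  qed
  have int: "integrable \<mu> (\<lambda>\<xi>. (norm (f \<xi> - trig_poly H Y \<xi>))\<^sup>2)"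
    if H: "finite H" "H \<subseteq> ?L" "G n \<subseteq> H" for H n
    using close[OF that] by (intro integrableI_bounded) (auto simp: le_less_trans)
  \<comment> \<open>Square integrability of \<open>f\<close> comes from
    \<open>f = (f - s 0) + s 0\<close>, the first summand being covered by
    \<open>int\<close>.\<close>
  have "integrable \<mu> (\<lambda>\<xi>. 2 * (norm (f \<xi> - s 0 \<xi>))\<^sup>2 + 2 * (norm (s 0 \<xi>))\<^sup>2)"
    using int[of "G 0" 0] G unfolding s_def
    by (intro Bochner_Integration.integrable_add integrable_mult_right int_sq) auto
  then have f_sq: "integrable \<mu> (\<lambda>\<xi>. (norm (f \<xi>))\<^sup>2)"
    by (rule Bochner_Integration.integrable_bound)
       (auto intro!: AE_I2 intro: order_trans[OF _ norm_add_sq_le[of "f \<xi> - s 0 \<xi>" "s 0 \<xi>" for \<xi>]])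
  have "((\<lambda>H. LINT \<xi>|\<mu>. (norm (f \<xi> - trig_poly H Y \<xi>))\<^sup>2) \<longlongrightarrow> 0) (finite_subsets_at_top ?L)"
  proof (rule tendstoI)
    fix e :: real assume "e > 0"
    then obtain n where n: "(1/4) ^ n < e / 4"
      using real_arch_pow_inv[of "e / 4" "1/4"] by auto
    show "\<forall>\<^sub>F H in finite_subsets_at_top ?L. dist (LINT \<xi>|\<mu>. (norm (f \<xi> - trig_poly H Y \<xi>))\<^sup>2) 0 < e"
      unfolding eventually_finite_subsets_at_top
    proof (intro exI[of _ "G n"] conjI G allI impI)
      fix H assume H: "finite H \<and> G n \<subseteq> H \<and> H \<subseteq> ?L"
      then have "ennreal (LINT \<xi>|\<mu>. (norm (f \<xi> - trig_poly H Y \<xi>))\<^sup>2) \<le> ennreal (4 * (1/4) ^ n)"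
        using close[of H n] nn_integral_eq_integral[OF int[of H n]] by auto
      then show "dist (LINT \<xi>|\<mu>. (norm (f \<xi> - trig_poly H Y \<xi>))\<^sup>2) 0 < e"
        using n by (subst (asm) ennreal_le_iff) auto
    qed
  qed
  with f_sq have "is_nu_fourier r N Y f"
    unfolding is_nu_fourier_def trig_poly_def \<mu>_def[symmetric] by auto
  then show ?thesis by blast
qed

subsection \<open>Synthesis of translates\<close>

lemma is_nu_fourier_integrable:
  assumes "is_nu_fourier r N Y f"
  shows "integrable (lebesgue_on (nu_Omega N)) (\<lambda>\<xi>. (norm (f \<xi> - trig_poly G Y \<xi>))\<^sup>2)"
proof -
  have [measurable]: "f \<in> borel_measurable (lebesgue_on (nu_Omega N))"
    using assms by (simp add: is_nu_fourier_def)
  have "integrable (lebesgue_on (nu_Omega N)) (\<lambda>\<xi>. 2 * (norm (f \<xi>))\<^sup>2 + 2 * (norm (trig_poly G Y \<xi>))\<^sup>2)"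
    using assms integrable_trig_poly_sq[of N G Y] by (simp add: is_nu_fourier_def)
  then show ?thesis
    by (rule Bochner_Integration.integrable_bound) (auto intro!: AE_I2 norm_diff_sq_le)
qed

lemma is_nu_fourier_tendsto:
  assumes "is_nu_fourier r N Y f"
  shows "((\<lambda>G. LINT \<xi>|lebesgue_on (nu_Omega N). (norm (f \<xi> - trig_poly G Y \<xi>))\<^sup>2) \<longlongrightarrow> 0)
           (finite_subsets_at_top (nu_Lambda r N))"
  using assms by (simp add: is_nu_fourier_def trig_poly_def)

text \<open>Multiplication by a character of frequency \<open>a\<close> shifts frequencies by
  \<open>a\<close>, so the product is a convolution of coefficients. The \<open>if\<close> extends
  the truncation of \<open>Y\<close> to \<open>G\<close> by zero; \<open>H\<close> need only contain
  all frequencies that arise.\<close>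

lemma scalar_mult_trig_poly:
  fixes Y :: "real \<Rightarrow> complex ^ 's"
  assumes "finite F" "finite G" "finite H" and H: "\<And>a l. a \<in> F \<Longrightarrow> l \<in> G \<Longrightarrow> l + a \<in> H"
  shows "(\<Sum>a\<in>F. c a * cis (2 * pi * a * \<xi>)) *s trig_poly G Y \<xi> =
    trig_poly H (\<lambda>l. \<Sum>a\<in>F. c a *s (if l - a \<in> G then Y (l - a) else 0)) \<xi>"
proof -
  have monomial: "(\<Sum>l\<in>H. (c a * cis (2 * pi * l * \<xi>)) *s (if l - a \<in> G then Y (l - a) else 0)) =
        (c a * cis (2 * pi * a * \<xi>)) *s trig_poly G Y \<xi>" if "a \<in> F" for a
  proof -
    have "(\<Sum>l\<in>H. (c a * cis (2 * pi * l * \<xi>)) *s (if l - a \<in> G then Y (l - a) else 0)) =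
      (\<Sum>l\<in>(\<lambda>l. l + a) ` G. (c a * cis (2 * pi * l * \<xi>)) *s (if l - a \<in> G then Y (l - a) else 0))"
      using assms that by (intro sum.mono_neutral_right) (force simp: image_iff)+
    also have "\<dots> = (\<Sum>l\<in>G. (c a * cis (2 * pi * (l + a) * \<xi>)) *s Y l)"
      by (subst sum.reindex) (auto simp: inj_on_def)
    also have "\<dots> = (\<Sum>l\<in>G. (c a * cis (2 * pi * a * \<xi>)) *s (cis (2 * pi * l * \<xi>) *s Y l))"
      by (intro sum.cong refl) (simp add: vector_smult_assoc algebra_simps flip: cis_mult)
    finally show ?thesis by (simp add: trig_poly_def vec.scale_sum_right)
  qed
  have "(\<Sum>a\<in>F. c a * cis (2 * pi * a * \<xi>)) *s trig_poly G Y \<xi> =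
     (\<Sum>a\<in>F. \<Sum>l\<in>H. (c a * cis (2 * pi * l * \<xi>)) *s (if l - a \<in> G then Y (l - a) else 0))"
    by (subst vec.scale_sum_left) (intro sum.cong refl monomial[symmetric])
  also have "\<dots> = (\<Sum>l\<in>H. \<Sum>a\<in>F. (c a * cis (2 * pi * l * \<xi>)) *s (if l - a \<in> G then Y (l - a) else 0))"
    by (rule sum.swap)
  finally show ?thesis
    by (simp only: trig_poly_def vec.scale_sum_right vector_smult_assoc mult.commute)
qed

text \<open>The vector-valued identity in dimension one.\<close>

lemma scalar_Parseval:
  assumes "N \<ge> 1" "odd r" "finite F" "F \<subseteq> nu_Lambda r N"
  shows "(LINT \<xi>|lebesgue_on (nu_Omega N). (cmod (\<Sum>a\<in>F. c a * cis (2 * pi * a * \<xi>)))\<^sup>2) =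
         (\<Sum>a\<in>F. (cmod (c a))\<^sup>2)"
  using trig_poly_Parseval[OF assms, of "\<lambda>a. vec (c a) :: complex ^ 1"]
  by (simp add: norm_vec_sq trig_poly_def mult.commute)

text \<open>Young's inequality, obtained from \<open>(t * x - y)\<^sup>2 \<ge> 0\<close>. A small
  \<open>t\<close> keeps the factor of \<open>x\<^sup>2\<close> near 1, which preserves the sharp
  constant \<open>\<theta>\<^sup>2\<close> in the synthesis bound.\<close>

lemma sq_sum_le_weighted:
  fixes x y t :: real assumes "t > 0"
  shows "(x + y)\<^sup>2 \<le> (1 + t) * x\<^sup>2 + (1 + 1 / t) * y\<^sup>2"
proof -
  have "0 \<le> (t * x - y)\<^sup>2 / t" using assms by simp
  also have "(t * x - y)\<^sup>2 / t = t * x\<^sup>2 + 1 / t * y\<^sup>2 - 2 * x * y"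
    using assms by (simp add: field_simps power2_eq_square)
  finally show ?thesis by (simp add: algebra_simps power2_sum)
qed

text \<open>On the Fourier side the synthesis operator of the translates \<open>Y (\<cdot> - a)\<close> is multiplication of
  \<open>f\<close> by the trigonometric polynomial with coefficients \<open>c\<close>. The frequencies \<open>a\<close> again lie
  in \<open>\<Lambda>\<close>, so Parseval applies to that polynomial as well.\<close>

lemma synthesis_bound:
  fixes Y :: "real \<Rightarrow> complex ^ 's"
  assumes "N \<ge> 1" "odd r" and F: "finite F" "F \<subseteq> range (\<lambda>n. 2 * real_of_int n)"
    and K: "finite K" "K \<subseteq> nu_Lambda r N"
    and f: "is_nu_fourier r N Y f" and bound: "AE \<xi> in lebesgue_on (nu_Omega N). norm (f \<xi>) \<le> \<theta>"
  shows "(\<Sum>l\<in>K. (norm (\<Sum>a\<in>F. c a *s Y (l - a)))\<^sup>2) \<le> \<theta>\<^sup>2 * (\<Sum>a\<in>F. (cmod (c a))\<^sup>2)"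
    (is "?S \<le> ?Q")
proof -
  let ?\<mu> = "lebesgue_on (nu_Omega N)" and ?L = "nu_Lambda r N"
  define p where "p \<xi> = (\<Sum>a\<in>F. c a * cis (2 * pi * a * \<xi>))" for \<xi>
  define C where "C = (\<Sum>a\<in>F. cmod (c a))"
  have p_le: "cmod (p \<xi>) \<le> C" for \<xi>
    unfolding p_def C_def by (rule order_trans[OF norm_sum]) (simp add: norm_mult)
  have p_int: "integrable ?\<mu> (\<lambda>\<xi>. (cmod (p \<xi>))\<^sup>2)"
    by (rule integrable_bounded_continuous[where B = "C\<^sup>2"])
       (auto intro!: power_mono p_le[unfolded p_def] continuous_intros simp: p_def[abs_def])
  have FL: "F \<subseteq> ?L" using F(2) even_in_nu_Lambda by blast
  have shift: "l + a \<in> ?L" "l - a \<in> ?L" if "l \<in> ?L" "a \<in> F" for l a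
    using F(2) that nu_Lambda_shift[of l r N] nu_Lambda_shift[of l r N "- _"] by force+
  define E where "E G = (LINT \<xi>|?\<mu>. (norm (f \<xi> - trig_poly G Y \<xi>))\<^sup>2)" for G
  \<comment> \<open>\<open>Y\<close> is replaced by its truncation to \<open>G\<close>, at the price
    of an error \<open>E G\<close>; only then are both factors trigonometric polynomials.\<close>
  have trunc: "?S \<le> (1 + t) * ?Q + (1 + 1 / t) * C\<^sup>2 * E G"
    if t: "t > 0" and G: "finite G" "G \<subseteq> ?L" "(\<lambda>(l, a). l - a) ` (K \<times> F) \<subseteq> G" for t G
  proof -
    define T where "T l = (\<Sum>a\<in>F. c a *s (if l - a \<in> G then Y (l - a) else 0))" for l
    define H where "H = K \<union> (\<lambda>(l, a). l + a) ` (G \<times> F)"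
    have H: "finite H" "H \<subseteq> ?L" "K \<subseteq> H"
      using K F G shift(1) by (auto simp: H_def subset_iff)
    have eq: "p \<xi> *s trig_poly G Y \<xi> = trig_poly H T \<xi>" for \<xi>
      unfolding p_def T_def using F G H by (intro scalar_mult_trig_poly) (auto simp: H_def)
    \<comment> \<open>\<open>G\<close> contains every difference \<open>l - a\<close> with
      \<open>l\<close> in \<open>K\<close> and \<open>a\<close> in \<open>F\<close>, so on
      \<open>K\<close> the cutoff is inactive.\<close>
    have "?S = (\<Sum>l\<in>K. (norm (T l))\<^sup>2)"
      unfolding T_def using G(3) by (intro sum.cong refl arg_cong[where f = "\<lambda>x. (norm x)\<^sup>2"]) force
    also have "\<dots> \<le> (\<Sum>l\<in>H. (norm (T l))\<^sup>2)"
      using H by (intro sum_mono2) auto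
    also have "\<dots> = (LINT \<xi>|?\<mu>. (norm (trig_poly H T \<xi>))\<^sup>2)"
      using H assms by (intro trig_poly_Parseval[symmetric])
    \<comment> \<open>In the main term \<open>p\<close> is kept, so that Parseval evaluates it
      exactly; in the error term the crude uniform bound \<open>C\<close> suffices, since
      \<open>E G\<close> tends to 0.\<close>
    also have "\<dots> \<le> (LINT \<xi>|?\<mu>. (1 + t) * \<theta>\<^sup>2 * (cmod (p \<xi>))\<^sup>2 +
        (1 + 1 / t) * C\<^sup>2 * (norm (f \<xi> - trig_poly G Y \<xi>))\<^sup>2)"
    proof (rule integral_mono_AE)
      show "AE \<xi> in ?\<mu>. (norm (trig_poly H T \<xi>))\<^sup>2 \<le> (1 + t) * \<theta>\<^sup>2 * (cmod (p \<xi>))\<^sup>2 +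
        (1 + 1 / t) * C\<^sup>2 * (norm (f \<xi> - trig_poly G Y \<xi>))\<^sup>2"
        using bound
      proof eventually_elim
        case (elim \<xi>)
        let ?e = "norm (f \<xi> - trig_poly G Y \<xi>)"
        have "norm (trig_poly G Y \<xi>) \<le> norm (f \<xi>) + ?e"
          by (metis norm_minus_commute norm_triangle_sub)
        then have "(norm (trig_poly G Y \<xi>))\<^sup>2 \<le> (\<theta> + ?e)\<^sup>2"
          using elim by (intro power_mono) auto
        also have "\<dots> \<le> (1 + t) * \<theta>\<^sup>2 + (1 + 1 / t) * ?e\<^sup>2"
          by (rule sq_sum_le_weighted[OF t])
        finally have "(cmod (p \<xi>))\<^sup>2 * (norm (trig_poly G Y \<xi>))\<^sup>2 \<le>
            (cmod (p \<xi>))\<^sup>2 * ((1 + t) * \<theta>\<^sup>2 + (1 + 1 / t) * ?e\<^sup>2)"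
          by (rule mult_left_mono) simp
        also have "\<dots> = (1 + t) * \<theta>\<^sup>2 * (cmod (p \<xi>))\<^sup>2 + (1 + 1 / t) * (cmod (p \<xi>))\<^sup>2 * ?e\<^sup>2"
          by (simp add: algebra_simps)
        also have "\<dots> \<le> (1 + t) * \<theta>\<^sup>2 * (cmod (p \<xi>))\<^sup>2 + (1 + 1 / t) * C\<^sup>2 * ?e\<^sup>2"
          using t p_le by (intro add_left_mono mult_right_mono mult_left_mono power_mono) auto
        finally show ?case
          by (simp add: norm_scalar_mult power_mult_distrib flip: eq)
      qed
    qed (use p_int is_nu_fourier_integrable[OF f] integrable_trig_poly_sq in auto)
    also have "\<dots> = (1 + t) * \<theta>\<^sup>2 * (LINT \<xi>|?\<mu>. (cmod (p \<xi>))\<^sup>2) + (1 + 1 / t) * C\<^sup>2 * E G"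
      using p_int is_nu_fourier_integrable[OF f] by (simp add: E_def)
    also have "(LINT \<xi>|?\<mu>. (cmod (p \<xi>))\<^sup>2) = (\<Sum>a\<in>F. (cmod (c a))\<^sup>2)"
      unfolding p_def using assms FL by (intro scalar_Parseval)
    finally show ?thesis by (simp add: mult.assoc)
  qed
  \<comment> \<open>First \<open>G\<close> grows with \<open>t\<close> fixed, which removes the
    error despite the factor \<open>1 + 1 / t\<close>; afterwards \<open>t\<close> can be made
    small.\<close>
  have lim: "?S \<le> (1 + t) * ?Q" if t: "t > 0" for t
  proof (rule tendsto_lowerbound)
    have "((\<lambda>G. (1 + t) * ?Q + (1 + 1 / t) * C\<^sup>2 * E G) \<longlongrightarrow> (1 + t) * ?Q + (1 + 1 / t) * C\<^sup>2 * 0)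
       (finite_subsets_at_top ?L)"
      unfolding E_def by (intro tendsto_intros is_nu_fourier_tendsto f)
    then show "((\<lambda>G. (1 + t) * ?Q + (1 + 1 / t) * C\<^sup>2 * E G) \<longlongrightarrow> (1 + t) * ?Q) (finite_subsets_at_top ?L)"
      by simp
    show "\<forall>\<^sub>F G in finite_subsets_at_top ?L. ?S \<le> (1 + t) * ?Q + (1 + 1 / t) * C\<^sup>2 * E G"
      unfolding eventually_finite_subsets_at_top
      using K F shift(2) trunc[OF t]
      by (intro exI[of _ "(\<lambda>(l, a). l - a) ` (K \<times> F)"]) auto
  qed simp
  have Q: "0 \<le> ?Q" by (simp add: sum_nonneg)
  show ?thesis
  proof (rule field_le_epsilon)
    fix e :: real assume "e > 0"
    \<comment> \<open>The choice \<open>t = e / (?Q + 1)\<close> makes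
      \<open>t * ?Q \<le> e\<close>; the added 1 covers the case \<open>?Q = 0\<close>.\<close>
    have "?S \<le> (1 + e / (?Q + 1)) * ?Q"
      using Q \<open>e > 0\<close> by (intro lim) (simp add: add_nonneg_pos)
    also have "\<dots> = ?Q + e * (?Q / (?Q + 1))"
      by (simp add: algebra_simps)
    also have "\<dots> \<le> ?Q + e * 1"
      using Q \<open>e > 0\<close> by (intro add_left_mono mult_left_mono) (auto simp: divide_le_eq_1)
    finally show "?S \<le> ?Q + e" by simp
  qed
qed

subsection \<open>Bessel bounds and perturbation\<close>

lemma ell2_inner_cmult: "ell2_inner L Z (\<lambda>l. c *s Y l) = cnj c * ell2_inner L Z Y"
  unfolding ell2_inner_def by (simp add: sum_distrib_left mult_ac flip: infsum_cmult_right')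

lemma ell2_inner_add:
  assumes "Z \<in> ell2 L" "X \<in> ell2 L" "Y \<in> ell2 L"
  shows "ell2_inner L Z (\<lambda>l. X l + Y l) = ell2_inner L Z X + ell2_inner L Z Y"
  unfolding ell2_inner_def
  by (subst infsum_add[symmetric]) (use assms in \<open>auto intro: ell2_inner_summable simp: sum.distrib distrib_left\<close>)

lemma L2_set_le_ell2_norm:
  assumes "Z \<in> ell2 L" "finite K" "K \<subseteq> L"
  shows "L2_set (\<lambda>l. norm (Z l)) K \<le> ell2_norm L Z"
proof (rule power2_le_imp_le)
  show "(L2_set (\<lambda>l. norm (Z l)) K)\<^sup>2 \<le> (ell2_norm L Z)\<^sup>2"
    using assms by (simp add: L2_set_def sum_nonneg ell2_norm_sq ell2_iff finite_sum_le_infsum)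
qed (rule ell2_norm_nonneg)

text \<open>Duality: with the coefficients \<open>c a\<close> themselves as weights, their square
  sum \<open>Q\<close> is the inner product of \<open>Z\<close> with the synthesized
  \<open>T\<close>. Cauchy-Schwarz and the synthesis bound give
  \<open>Q \<le> ell2_norm Z * \<theta> * sqrt Q\<close>, and one factor \<open>sqrt Q\<close>
  cancels.\<close>

lemma translates_Bessel:
  fixes Z Y :: "real \<Rightarrow> complex ^ 's"
  assumes "N \<ge> 1" "odd r" and F: "finite F" "F \<subseteq> range (\<lambda>n. 2 * real_of_int n)"
    and Z: "Z \<in> ell2 (nu_Lambda r N)" and Y: "Y \<in> ell2 (nu_Lambda r N)"
    and f: "is_nu_fourier r N Y f" "AE \<xi> in lebesgue_on (nu_Omega N). norm (f \<xi>) \<le> \<theta>"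
    and "\<theta> \<ge> 0"
  shows "(\<Sum>a\<in>F. (cmod (ell2_inner (nu_Lambda r N) Z (translate a Y)))\<^sup>2) \<le>
         \<theta>\<^sup>2 * (ell2_norm (nu_Lambda r N) Z)\<^sup>2"
proof -
  let ?L = "nu_Lambda r N"
  define c where "c a = ell2_inner ?L Z (translate a Y)" for a
  define T where "T l = (\<Sum>a\<in>F. c a *s Y (l - a))" for l
  define Q where "Q = (\<Sum>a\<in>F. (cmod (c a))\<^sup>2)"
  define B where "B = ell2_norm ?L Z * (\<theta> * sqrt Q)"
  have Q_nonneg: "Q \<ge> 0" by (simp add: Q_def sum_nonneg)
  \<comment> \<open>Inner products are treated as limits over finite \<open>K\<close>, since the
    synthesis bound is stated for finite sets of positions.\<close>
  have "((\<lambda>K. \<Sum>l\<in>K. \<Sum>k\<in>UNIV. Z l $ k * cnj (translate a Y l $ k)) \<longlongrightarrow> c a)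
      (finite_subsets_at_top ?L)" if "a \<in> F" for a
  proof -
    from F(2) that have "translate a Y \<in> ell2 ?L" using Y ell2_translate by blast
    then show ?thesis
      using has_sum_infsum[OF ell2_inner_summable[OF Z]] by (auto simp: has_sum_def c_def ell2_inner_def)
  qed
  then have "((\<lambda>K. \<Sum>a\<in>F. cnj (c a) * (\<Sum>l\<in>K. \<Sum>k\<in>UNIV. Z l $ k * cnj (translate a Y l $ k))) \<longlongrightarrow>
      (\<Sum>a\<in>F. cnj (c a) * c a)) (finite_subsets_at_top ?L)"
    by (intro tendsto_sum tendsto_mult_left)
  also have "(\<lambda>K. \<Sum>a\<in>F. cnj (c a) * (\<Sum>l\<in>K. \<Sum>k\<in>UNIV. Z l $ k * cnj (translate a Y l $ k))) =
      (\<lambda>K. \<Sum>l\<in>K. \<Sum>k\<in>UNIV. Z l $ k * cnj (T l $ k))"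
  proof
    fix K :: "real set"
    have "(\<Sum>a\<in>F. cnj (c a) * (\<Sum>l\<in>K. \<Sum>k\<in>UNIV. Z l $ k * cnj (translate a Y l $ k))) =
        (\<Sum>a\<in>F. \<Sum>l\<in>K. \<Sum>k\<in>UNIV. Z l $ k * cnj (c a * Y (l - a) $ k))"
      by (simp add: sum_distrib_left translate_def mult_ac)
    also have "\<dots> = (\<Sum>l\<in>K. \<Sum>a\<in>F. \<Sum>k\<in>UNIV. Z l $ k * cnj (c a * Y (l - a) $ k))"
      by (rule sum.swap)
    also have "\<dots> = (\<Sum>l\<in>K. \<Sum>k\<in>UNIV. \<Sum>a\<in>F. Z l $ k * cnj (c a * Y (l - a) $ k))"
      by (intro sum.cong refl sum.swap)
    finally show "(\<Sum>a\<in>F. cnj (c a) * (\<Sum>l\<in>K. \<Sum>k\<in>UNIV. Z l $ k * cnj (translate a Y l $ k))) =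
        (\<Sum>l\<in>K. \<Sum>k\<in>UNIV. Z l $ k * cnj (T l $ k))"
      by (simp add: T_def sum_distrib_left)
  qed
  also have "(\<Sum>a\<in>F. cnj (c a) * c a) = of_real Q"
    by (simp only: Q_def of_real_sum complex_norm_square mult.commute)
  finally have lim: "((\<lambda>K. \<Sum>l\<in>K. \<Sum>k\<in>UNIV. Z l $ k * cnj (T l $ k)) \<longlongrightarrow> of_real Q) (finite_subsets_at_top ?L)" .
  have "cmod (of_real Q) \<le> B"
  proof (rule tendsto_upperbound[OF tendsto_norm[OF lim]])
    show "\<forall>\<^sub>F K in finite_subsets_at_top ?L. cmod (\<Sum>l\<in>K. \<Sum>k\<in>UNIV. Z l $ k * cnj (T l $ k)) \<le> B"
    proof (rule eventually_finite_subsets_at_top_weakI)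
      fix K assume K: "finite K" "K \<subseteq> ?L"
      have "cmod (\<Sum>l\<in>K. \<Sum>k\<in>UNIV. Z l $ k * cnj (T l $ k)) \<le> (\<Sum>l\<in>K. \<bar>norm (Z l)\<bar> * \<bar>norm (T l)\<bar>)"
        by (rule sum_norm_le) (simp add: vec_Cauchy_Schwarz)
      also have "\<dots> \<le> L2_set (\<lambda>l. norm (Z l)) K * L2_set (\<lambda>l. norm (T l)) K"
        by (rule L2_set_mult_ineq)
      also have "\<dots> \<le> ell2_norm ?L Z * (\<theta> * sqrt Q)"
      proof (intro mult_mono L2_set_le_ell2_norm Z K L2_set_nonneg ell2_norm_nonneg)
        show "L2_set (\<lambda>l. norm (T l)) K \<le> \<theta> * sqrt Q"
          using synthesis_bound[OF assms(1-4) K f, of c] \<open>\<theta> \<ge> 0\<close>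
          unfolding L2_set_def T_def[symmetric] Q_def[symmetric]
          by (intro real_le_lsqrt) (auto simp: power_mult_distrib Q_nonneg)
      qed
      finally show "cmod (\<Sum>l\<in>K. \<Sum>k\<in>UNIV. Z l $ k * cnj (T l $ k)) \<le> B" by (simp add: B_def)
    qed
  qed simp
  then have "sqrt Q * sqrt Q \<le> (ell2_norm ?L Z * \<theta>) * sqrt Q"
    using Q_nonneg by (simp add: B_def mult_ac)
  then have "sqrt Q \<le> ell2_norm ?L Z * \<theta>"
    using Q_nonneg \<open>\<theta> \<ge> 0\<close> ell2_norm_nonneg[of ?L Z]
    by (cases "Q = 0") (auto intro: mult_right_le_imp_le[of _ "sqrt Q"])
  then have "(sqrt Q)\<^sup>2 \<le> (ell2_norm ?L Z * \<theta>)\<^sup>2"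
    using Q_nonneg by (intro power_mono) auto
  then show ?thesis
    using Q_nonneg by (simp add: Q_def c_def power_mult_distrib mult.commute)
qed

text \<open>Modulation and translation commute up to a unimodular phase, which disappears in the
  moduli of the coefficients. This turns the system into translates of modulated windows, the
  sequences whose transforms are assumed bounded.\<close>

lemma modulate_translate:
  "modulate t (translate a Y) = (\<lambda>l. cis (2 * pi * t * a) *s translate a (modulate t Y) l)"
  by (rule ext) (simp add: modulate_def translate_def vector_smult_assoc cis_mult algebra_simps)

text \<open>Each of the \<open>M * (P + 1)\<close> pairs \<open>(m, j)\<close> contributes one
  family of translates with Bessel bound \<open>\<theta>\<^sup>2\<close>.\<close>

lemma gabor_Bessel:
  fixes Z :: "real \<Rightarrow> complex ^ 's" and U :: "nat \<Rightarrow> real \<Rightarrow> complex ^ 's"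
  assumes "N \<ge> 1" "odd r" and F: "finite F" "F \<subseteq> {0..<M} \<times> {0..P} \<times> nu_Lambda r N"
    and Z: "Z \<in> ell2 (nu_Lambda r N)"
    and U: "\<And>j. j \<in> {0..P} \<Longrightarrow> U j \<in> ell2 (nu_Lambda r N)" and "\<theta> \<ge> 0"
    and bound: "\<And>m j. m \<in> {0..<M} \<Longrightarrow> j \<in> {0..P} \<Longrightarrow>
           AE \<xi> in lebesgue_on (nu_Omega N).
             norm (nu_fourier r N (modulate (real m / real M) (U j)) \<xi>) \<le> \<theta>"
  shows "(\<Sum>i\<in>F. (cmod (ell2_inner (nu_Lambda r N) Z (dvnug_system N M U i)))\<^sup>2) \<le>
         real (M * (P + 1)) * (\<theta>\<^sup>2 * (ell2_norm (nu_Lambda r N) Z)\<^sup>2)"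
proof -
  let ?L = "nu_Lambda r N"
  define K where "K = (\<lambda>(m, j, l). l) ` F"
  have K: "finite K" "K \<subseteq> ?L" using F by (auto simp: K_def)
  have inner: "(\<Sum>l\<in>K. (cmod (ell2_inner ?L Z (dvnug_system N M U (m, j, l))))\<^sup>2) \<le> \<theta>\<^sup>2 * (ell2_norm ?L Z)\<^sup>2"
    if mj: "m \<in> {0..<M}" "j \<in> {0..P}" for m j
  proof -
    let ?Y = "modulate (real m / real M) (U j)"
    have Y: "?Y \<in> ell2 ?L" using U[OF mj(2)] by (simp add: ell2_modulate)
    \<comment> \<open>By existence, the representative picked by \<open>SOME\<close> really is a
      transform, so the assumed bound speaks about it.\<close>
    have "is_nu_fourier r N ?Y (nu_fourier r N ?Y)"
      unfolding nu_fourier_def by (rule someI_ex[OF nu_fourier_exists[OF assms(1,2) Y]])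
    moreover have "(\<lambda>l. 2 * real N * l) ` K \<subseteq> range (\<lambda>n. 2 * real_of_int n)"
    proof (rule image_subsetI)
      fix l assume "l \<in> K"
      then obtain n where "2 * real N * l = 2 * real_of_int n"
        using nu_Lambda_dilate[OF \<open>N \<ge> 1\<close>] K(2) by blast
      then show "2 * real N * l \<in> range (\<lambda>n. 2 * real_of_int n)"
        by (rule range_eqI)
    qed
    ultimately have "(\<Sum>a\<in>(\<lambda>l. 2 * real N * l) ` K. (cmod (ell2_inner ?L Z (translate a ?Y)))\<^sup>2) \<le> \<theta>\<^sup>2 * (ell2_norm ?L Z)\<^sup>2"
      using K Y Z assms mj by (intro translates_Bessel bound) auto
    \<comment> \<open>Distinct \<open>l\<close> give distinct shifts because \<open>N\<close> is
      positive, so no member is lost in the image.\<close>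
    also have "(\<Sum>a\<in>(\<lambda>l. 2 * real N * l) ` K. (cmod (ell2_inner ?L Z (translate a ?Y)))\<^sup>2) =
        (\<Sum>l\<in>K. (cmod (ell2_inner ?L Z (translate (2 * real N * l) ?Y)))\<^sup>2)"
      using \<open>N \<ge> 1\<close> by (subst sum.reindex) (auto simp: inj_on_def)
    also have "\<dots> = (\<Sum>l\<in>K. (cmod (ell2_inner ?L Z (dvnug_system N M U (m, j, l))))\<^sup>2)"
      unfolding dvnug_system_def split modulate_translate ell2_inner_cmult by (simp add: norm_mult)
    finally show ?thesis .
  qed
  \<comment> \<open>Enlarging \<open>F\<close> to a box lets the sum split over the pairs
    \<open>(m, j)\<close>.\<close>
  have "(\<Sum>i\<in>F. (cmod (ell2_inner ?L Z (dvnug_system N M U i)))\<^sup>2) \<le>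
      (\<Sum>i\<in>{0..<M} \<times> {0..P} \<times> K. (cmod (ell2_inner ?L Z (dvnug_system N M U i)))\<^sup>2)"
    using F K by (intro sum_mono2) (force simp: K_def image_iff)+
  also have "\<dots> = (\<Sum>m\<in>{0..<M}. \<Sum>j\<in>{0..P}. \<Sum>l\<in>K. (cmod (ell2_inner ?L Z (dvnug_system N M U (m, j, l))))\<^sup>2)"
    by (simp add: sum.cartesian_product split_def)
  also have "\<dots> \<le> (\<Sum>m\<in>{0..<M}. \<Sum>j\<in>{0..P}. \<theta>\<^sup>2 * (ell2_norm ?L Z)\<^sup>2)"
    by (intro sum_mono inner)
  also have "\<dots> = real (M * (P + 1)) * (\<theta>\<^sup>2 * (ell2_norm ?L Z)\<^sup>2)"
    by (simp add: mult.assoc distrib_left distrib_right)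
  finally show ?thesis .
qed

section \<open>Comparison of the analysis coefficients\<close>

lemma dvnug_system_ell2:
  assumes "N \<ge> 1" "\<And>j. j \<in> {0..P} \<Longrightarrow> W j \<in> ell2 (nu_Lambda r N)"
    "i \<in> {0..<M} \<times> {0..P} \<times> nu_Lambda r N"
  shows "dvnug_system N M W i \<in> ell2 (nu_Lambda r N)"
proof -
  obtain m j l where i: "i = (m, j, l)" "j \<in> {0..P}" "l \<in> nu_Lambda r N"
    using assms(3) by auto
  obtain n where n: "2 * real N * l = 2 * real_of_int n"
    using nu_Lambda_dilate[OF assms(1) i(3)] .
  have "translate (2 * real N * l) (W j) \<in> ell2 (nu_Lambda r N)"
    unfolding n by (intro ell2_translate assms i)
  then show ?thesis by (simp add: dvnug_system_def i ell2_modulate)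
qed

lemma dvnug_system_add:
  "dvnug_system N M (\<lambda>j l. W j l + V j l) i = (\<lambda>l. dvnug_system N M W i l + dvnug_system N M V i l)"
  by (cases i) (simp add: dvnug_system_def modulate_def translate_def vector_add_ldistrib)

text \<open>Minkowski's inequality on finite subsets, with the right-hand side already replaced by
  the full sums.\<close>

lemma sqrt_infsum_triangle:
  fixes u v :: "'a \<Rightarrow> 'b::real_normed_vector"
  assumes "(\<lambda>i. (norm (u i))\<^sup>2) summable_on I" "(\<lambda>i. (norm (v i))\<^sup>2) summable_on I"
    "(\<lambda>i. (norm (u i + v i))\<^sup>2) summable_on I"
  shows "sqrt (\<Sum>\<^sub>\<infinity>i\<in>I. (norm (u i + v i))\<^sup>2) \<le>
         sqrt (\<Sum>\<^sub>\<infinity>i\<in>I. (norm (u i))\<^sup>2) + sqrt (\<Sum>\<^sub>\<infinity>i\<in>I. (norm (v i))\<^sup>2)"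
    (is "_ \<le> sqrt ?u + sqrt ?v")
proof (rule real_le_lsqrt)
  have nonneg: "0 \<le> ?u" "0 \<le> ?v" by (auto intro: infsum_nonneg)
  then show "0 \<le> sqrt ?u + sqrt ?v" by simp
  show "(\<Sum>\<^sub>\<infinity>i\<in>I. (norm (u i + v i))\<^sup>2) \<le> (sqrt ?u + sqrt ?v)\<^sup>2"
  proof (rule infsum_le_finite_sums[OF assms(3)])
    fix F assume F: "finite F" "F \<subseteq> I"
    have "(\<Sum>i\<in>F. (norm (u i + v i))\<^sup>2) = (L2_set (\<lambda>i. norm (u i + v i)) F)\<^sup>2"
      by (simp add: L2_set_def sum_nonneg)
    also have "\<dots> \<le> (L2_set (\<lambda>i. norm (u i) + norm (v i)) F)\<^sup>2"
      by (intro power_mono L2_set_mono norm_triangle_ineq L2_set_nonneg) auto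
    also have "\<dots> \<le> (L2_set (\<lambda>i. norm (u i)) F + L2_set (\<lambda>i. norm (v i)) F)\<^sup>2"
      by (intro power_mono L2_set_triangle_ineq L2_set_nonneg)
    also have "\<dots> \<le> (sqrt ?u + sqrt ?v)\<^sup>2"
      unfolding L2_set_def using F assms
      by (intro power_mono add_mono real_sqrt_le_mono finite_sum_le_infsum) (auto simp: sum_nonneg)
    finally show "(\<Sum>i\<in>F. (norm (u i + v i))\<^sup>2) \<le> (sqrt ?u + sqrt ?v)\<^sup>2" .
  qed
qed

theorem theorem4p1:
  fixes N M P r :: nat
    and W V :: "nat \<Rightarrow> real \<Rightarrow> complex ^ 's"
    and A\<^sub>0 B\<^sub>0 \<theta> :: real
  assumes "N \<ge> 1" and "M \<ge> 1"
    and "odd r" and "coprime r N" and "1 \<le> r" and "r \<le> 2 * N - 1"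
    and "dvnug_frame r N M P W A\<^sub>0 B\<^sub>0"
    and "\<And>j. j \<in> {0..P} \<Longrightarrow> V j \<in> ell2 (nu_Lambda r N)"
    and "\<theta> > 0"
    and "\<And>m j. m \<in> {0..<M} \<Longrightarrow> j \<in> {0..P} \<Longrightarrow>
           AE \<xi> in lebesgue_on (nu_Omega N).
             norm (nu_fourier r N (modulate (real m / real M) (\<lambda>l. W j l + V j l)) \<xi>) \<le> \<theta>"
    and "\<theta> < 2 ^ (M + P) * \<theta>\<^sup>2 * real CARD('s)"
    and "2 ^ (M + P) * \<theta>\<^sup>2 * real CARD('s) < A\<^sub>0"
  shows "dvnug_frame r N M P V
           ((sqrt A\<^sub>0 - sqrt (2 ^ (M + P) * \<theta>\<^sup>2 * real CARD('s)))\<^sup>2)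
           (2 ^ (M + P + 1) * \<theta>\<^sup>2 * real CARD('s) + 2 * B\<^sub>0)"
proof -
  let ?L = "nu_Lambda r N"
  define D where "D = 2 ^ (M + P) * \<theta>\<^sup>2 * real CARD('s)"
  have D: "0 < D" "D < A\<^sub>0" using assms(9,11,12) by (auto simp: D_def)
  have frame: "j \<in> {0..P} \<Longrightarrow> W j \<in> ell2 ?L" "A\<^sub>0 \<le> B\<^sub>0" for j
    using assms(7) by (auto simp: dvnug_frame_def)
  have sqrtD: "sqrt D < sqrt A\<^sub>0" "0 \<le> sqrt D" using D by simp_all
  define U where "U j l = W j l + V j l" for j l
  define I where "I = {0..<M} \<times> {0..P} \<times> ?L"
  \<comment> \<open>From \<open>M \<le> 2 ^ M\<close>, \<open>P + 1 \<le> 2 ^ P\<close> and positive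
    dimension: the Bessel constant of the perturbation is dominated by the stated one.\<close>
  have "real (M * (P + 1)) * \<theta>\<^sup>2 \<le> D"
  proof -
    have "M * (P + 1) \<le> 2 ^ M * 2 ^ P"
      using Suc_leI[OF less_exp[of P]] by (intro mult_mono) auto
    also have "\<dots> \<le> 2 ^ (M + P) * CARD('s)"
      by (simp add: power_add Suc_le_eq)
    finally have "real (M * (P + 1)) \<le> real (2 ^ (M + P) * CARD('s))"
      by (rule of_nat_mono)
    then have "real (M * (P + 1)) * \<theta>\<^sup>2 \<le> real (2 ^ (M + P) * CARD('s)) * \<theta>\<^sup>2"
      by (rule mult_right_mono) simp
    then show ?thesis by (simp add: D_def mult_ac)
  qed
  then have Bessel: "real (M * (P + 1)) * (\<theta>\<^sup>2 * (ell2_norm ?L Z)\<^sup>2) \<le> D * (ell2_norm ?L Z)\<^sup>2" for Z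
    by (simp only: mult.assoc[symmetric]) (rule mult_right_mono, auto)
  show ?thesis
    unfolding dvnug_frame_def Let_def I_def[symmetric] D_def[symmetric]
  proof (intro conjI ballI)
    show "0 < (sqrt A\<^sub>0 - sqrt D)\<^sup>2" using sqrtD by simp
    \<comment> \<open>A frame requires ordered bounds; here the new lower bound is at most
      \<open>A\<^sub>0\<close>, hence at most \<open>B\<^sub>0\<close>.\<close>
    have "(sqrt A\<^sub>0 - sqrt D)\<^sup>2 \<le> (sqrt A\<^sub>0)\<^sup>2"
      using sqrtD by (intro power_mono) auto
    also have "\<dots> \<le> 2 * D + 2 * B\<^sub>0" using D frame(2) by simp
    finally have "(sqrt A\<^sub>0 - sqrt D)\<^sup>2 \<le> 2 * D + 2 * B\<^sub>0" .
    then show "(sqrt A\<^sub>0 - sqrt D)\<^sup>2 \<le> 2 ^ (M + P + 1) * \<theta>\<^sup>2 * real CARD('s) + 2 * B\<^sub>0"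
      by (simp add: D_def)
  next
    fix j assume "j \<in> {0..P}" then show "V j \<in> ell2 ?L" by (rule assms)
  next
    fix Z :: "real \<Rightarrow> complex ^ 's" assume Z: "Z \<in> ell2 ?L"
    define w where "w i = ell2_inner ?L Z (dvnug_system N M W i)" for i
    define v where "v i = ell2_inner ?L Z (dvnug_system N M V i)" for i
    define u where "u i = ell2_inner ?L Z (dvnug_system N M U i)" for i
    let ?z = "(ell2_norm ?L Z)\<^sup>2"
    let ?w = "\<Sum>\<^sub>\<infinity>i\<in>I. (cmod (w i))\<^sup>2" and ?u = "\<Sum>\<^sub>\<infinity>i\<in>I. (cmod (u i))\<^sup>2" and ?v = "\<Sum>\<^sub>\<infinity>i\<in>I. (cmod (v i))\<^sup>2"
    have w: "(\<lambda>i. (cmod (w i))\<^sup>2) summable_on I" "A\<^sub>0 * ?z \<le> ?w" "?w \<le> B\<^sub>0 * ?z"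
      using assms(7) Z by (auto simp: dvnug_frame_def Let_def w_def I_def)
    \<comment> \<open>The coefficients of \<open>W + V\<close> have Bessel bound \<open>D\<close>.
      Bounding finite sums first is what yields summability.\<close>
    have u_fin: "(\<Sum>i\<in>F. (cmod (u i))\<^sup>2) \<le> D * ?z" if "finite F" "F \<subseteq> I" for F
      unfolding u_def using that Z assms frame unfolding I_def
      by (intro order_trans[OF gabor_Bessel[where \<theta> = \<theta>] Bessel]) (auto simp: U_def[abs_def] intro!: ell2_add)
    have u: "(\<lambda>i. (cmod (u i))\<^sup>2) summable_on I"
      using u_fin by (intro nonneg_bounded_partial_sums_imp_summable_on[where C = "D * ?z"]
        eventually_finite_subsets_at_top_weakI) auto
    have u_le: "?u \<le> D * ?z" by (rule infsum_le_finite_sums[OF u u_fin])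
    have uwv: "u i = w i + v i" if "i \<in> I" for i
      using that Z assms frame unfolding u_def w_def v_def I_def U_def dvnug_system_add
      by (intro ell2_inner_add dvnug_system_ell2) auto
    have uw: "(\<lambda>i. 2 * (cmod (u i))\<^sup>2 + 2 * (cmod (w i))\<^sup>2) summable_on I"
      using u w by (intro summable_on_add summable_on_cmult_right)
    \<comment> \<open>Here \<open>v = u - w\<close>; the constant 2 produces both
      \<open>2 * B\<^sub>0\<close> and the exponent \<open>M + P + 1\<close> in the upper
      bound.\<close>
    have v_le: "(cmod (v i))\<^sup>2 \<le> 2 * (cmod (u i))\<^sup>2 + 2 * (cmod (w i))\<^sup>2" if "i \<in> I" for i
      using norm_diff_sq_le[of "u i" "w i"] uwv[OF that] by simp
    have v: "(\<lambda>i. (cmod (v i))\<^sup>2) summable_on I"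
      by (rule summable_on_comparison_test[OF uw]) (auto intro: v_le)
    show "(\<lambda>i. (cmod (ell2_inner ?L Z (dvnug_system N M V i)))\<^sup>2) summable_on I"
      using v by (simp add: v_def)
    have "?v \<le> (\<Sum>\<^sub>\<infinity>i\<in>I. 2 * (cmod (u i))\<^sup>2 + 2 * (cmod (w i))\<^sup>2)"
      by (rule infsum_mono[OF v uw v_le])
    also have "\<dots> = 2 * ?u + 2 * ?w"
      using u w by (simp add: infsum_add summable_on_cmult_right infsum_cmult_right')
    also have "\<dots> \<le> (2 * D + 2 * B\<^sub>0) * ?z"
      using u_le w by (simp add: algebra_simps)
    finally show "(\<Sum>\<^sub>\<infinity>i\<in>I. (cmod (ell2_inner ?L Z (dvnug_system N M V i)))\<^sup>2) \<le>
        (2 ^ (M + P + 1) * \<theta>\<^sup>2 * real CARD('s) + 2 * B\<^sub>0) * ?z"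
      by (simp add: v_def D_def mult_ac)
    \<comment> \<open>For the lower bound the roles change: \<open>w = u - v\<close>, so the large
      coefficients \<open>w\<close> are controlled by the small \<open>u\<close> and by
      \<open>v\<close>.\<close>
    have w_eq: "(cmod (u i + - v i))\<^sup>2 = (cmod (w i))\<^sup>2" if "i \<in> I" for i
      using uwv[OF that] by simp
    then have "(\<lambda>i. (cmod (u i + - v i))\<^sup>2) summable_on I"
      using w(1) by (simp cong: summable_on_cong)
    then have "sqrt (\<Sum>\<^sub>\<infinity>i\<in>I. (cmod (u i + - v i))\<^sup>2) \<le> sqrt ?u + sqrt ?v"
      using sqrt_infsum_triangle[of u I "\<lambda>i. - v i"] u v by simp
    then have "sqrt ?w \<le> sqrt ?u + sqrt ?v"
      by (simp only: w_eq cong: infsum_cong)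
    moreover have "sqrt (A\<^sub>0 * ?z) \<le> sqrt ?w" "sqrt ?u \<le> sqrt (D * ?z)"
      using w u_le by simp_all
    ultimately have "(sqrt A\<^sub>0 - sqrt D) * ell2_norm ?L Z \<le> sqrt ?v"
      by (simp add: real_sqrt_mult ell2_norm_nonneg algebra_simps)
    \<comment> \<open>Squaring preserves the inequality because \<open>D < A\<^sub>0\<close> makes
      the left side nonnegative.\<close>
    then have "((sqrt A\<^sub>0 - sqrt D) * ell2_norm ?L Z)\<^sup>2 \<le> (sqrt ?v)\<^sup>2"
      using sqrtD ell2_norm_nonneg[of ?L Z] by (intro power_mono) auto
    also have "(sqrt ?v)\<^sup>2 = ?v" by (simp add: infsum_nonneg)
    finally show "(sqrt A\<^sub>0 - sqrt D)\<^sup>2 * ?z \<le> (\<Sum>\<^sub>\<infinity>i\<in>I. (cmod (ell2_inner ?L Z (dvnug_system N M V i)))\<^sup>2)"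
      by (simp add: power_mult_distrib v_def)
  qed
qed

end
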